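(* Let $(G,X)$ be a flow such that $\dim X=0$ and $G$ is compactly generated by $\Gamma$. Then the following conditions are pairwise equivalent: (1) $(G,X)$ is pointwise product $\Gamma$-recurrent of type I, i.e. every point of $X\times X$ is $\Gamma$-recurrent of type I under $(G,X\times X)$, $t(x,y)=(tx,ty)$. (2) $(G,X)$ is a distal flow. (3) $(G,X)$ is an equicontinuous flow.
   Context: A Hausdorff para-topological group is a group with a Hausdorff topology for which multiplication $G\times G\to G$ is jointly continuous (inversion need not be continuous). A flow $(G,X)$ consists of a Hausdorff para-topological group $G$, a locally compact Hausdorff uniform space $X$ (uniformity $\mathscr{U}$), and a jointly continuous map $G\times X\to X$, $(t,x)\mapsto tx$, with $ex=x$ and $(st)x=s(tx)$, such that $\overline{Gx}$ is compact for every $x\in X$. $\dim X=0$ means $X$ has a base of clopen sets. $G$ is compactly generated by $\Gamma$ if $\Gamma\subseteq G$ is compact, $e\in\Gamma=\Gamma^{-1}$ and $G=\bigcup_{r\ge1}\Gamma^r$. For a Hausdorff space $Y$, $2^Y$ is the collection of closed subsets; for a net $\{Y_i\}$ in $2^Y$, write $Y_i\rightharpoonup K$ if $K$ is the set of all $y\in Y$ for which there are a subnet $\{Y_{i_k}\}$ and $y_{i_k}\in Y_{i_k}$ with $y_{i_k}\to y$. For $g\ne e$ in $G$, $|g|$ is the least $r$ with $g\in\Gamma^r$, and $\boldsymbol{K}(g)=\Gamma^{|g|-1}g$ with $\Gamma^0=\{e\}$. A $\Gamma$-cone is a set $\boldsymbol{C}\subseteq G$ such that $\boldsymbol{K}(g_i)\rightharpoonup\boldsymbol{C}$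 in $2^G$ for some net $\{g_i\}$ in $G\setminus\{e\}$ with $|g_i|\to\infty$ and $|g_i|\le|g_{i'}|$ whenever $i\le i'$. A point $z$ of a flow $(G,Z)$ is $\Gamma$-recurrent of type I if $\boldsymbol{C}z\cap U\ne\emptyset$ for every $\Gamma$-cone $\boldsymbol{C}$ and every neighborhood $U$ of $z$. $(G,X)$ is distal if for all $x\ne y$ in $X$ the closure of $\{(gx,gy):g\in G\}$ in $X\times X$ is disjoint from the diagonal. $(G,X)$ is equicontinuous if for every $x\in X$ and $\varepsilon\in\mathscr{U}$ there is a neighborhood $U$ of $x$ with $gU\subseteq\varepsilon[gx]$ for all $g\in G$, where $\varepsilon[y]=\{z:(y,z)\in\varepsilon\}$. *)

theory Defs
  imports "HOL-Analysis.Analysis" "HOL-Library.Set_Algebras"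
begin

section \<open>Flows\<close>

text \<open>
  The acting group is written additively, since the library's class of arbitrary (not necessarily
  commutative) groups is \<^class>\<open>group_add\<close>. Joint continuity of the group operation is
  \<^class>\<open>topological_monoid_add\<close>; no continuity of inversion is assumed.
\<close>

definition flow ::
    "('g::{group_add, topological_monoid_add, t2_space} \<Rightarrow> 'x::{uniform_space, t2_space} \<Rightarrow> 'x) \<Rightarrow> bool"
  where "flow act \<longleftrightarrow>
    locally compact (UNIV :: 'x set) \<and>
    continuous_on UNIV (\<lambda>(t, x). act t x) \<and>
    (\<forall>x. act 0 x = x) \<and>
    (\<forall>s t x. act (s + t) x = act s (act t x)) \<and>
    (\<forall>x. compact (closure (range (\<lambda>t. act t x))))"

definition clopen_base :: "'x::topological_space itself \<Rightarrow> bool"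
  where "clopen_base _ \<longleftrightarrow> (\<exists>B :: 'x set set. topological_basis B \<and> (\<forall>U\<in>B. open U \<and> closed U))"

definition distal :: "('g \<Rightarrow> 'x::topological_space \<Rightarrow> 'x) \<Rightarrow> bool"
  where "distal act \<longleftrightarrow>
    (\<forall>x y. x \<noteq> y \<longrightarrow> closure (range (\<lambda>g. (act g x, act g y))) \<inter> Id = {})"

definition equicontinuous :: "('g \<Rightarrow> 'x::uniform_space \<Rightarrow> 'x) \<Rightarrow> bool"
  where "equicontinuous act \<longleftrightarrow>
    (\<forall>x \<epsilon>. (\<forall>\<^sub>F p in uniformity. p \<in> \<epsilon>) \<longrightarrow>
      (\<exists>U. open U \<and> x \<in> U \<and> (\<forall>g. act g ` U \<subseteq> \<epsilon> `` {act g x})))"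

definition prod_act :: "('g \<Rightarrow> 'x \<Rightarrow> 'x) \<Rightarrow> 'g \<Rightarrow> 'x \<times> 'x \<Rightarrow> 'x \<times> 'x"
  where "prod_act act t = (\<lambda>(x, y). (act t x, act t y))"


section \<open>Word length\<close>

text \<open>In additive notation \<open>\<Gamma>\<^sup>r\<close> is the \<open>r\<close>-fold sumset.\<close>

primrec sumset_power :: "'g::group_add set \<Rightarrow> nat \<Rightarrow> 'g set"
  where
    "sumset_power \<Gamma> 0 = {0}"
  | "sumset_power \<Gamma> (Suc r) = sumset_power \<Gamma> r + \<Gamma>"

definition compactly_generated_by :: "'g::{group_add, topological_space} set \<Rightarrow> bool"
  where "compactly_generated_by \<Gamma> \<longleftrightarrow>
    compact \<Gamma> \<and> 0 \<in> \<Gamma> \<and> uminus ` \<Gamma> = \<Gamma> \<and> (\<Union>r\<in>{1..}. sumset_power \<Gamma> r) = UNIV"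

definition word_length :: "'g::group_add set \<Rightarrow> 'g \<Rightarrow> nat"
  where "word_length \<Gamma> g = (LEAST r. g \<in> sumset_power \<Gamma> r)"

definition cone_piece :: "'g::group_add set \<Rightarrow> 'g \<Rightarrow> 'g set"
  where "cone_piece \<Gamma> g = sumset_power \<Gamma> (word_length \<Gamma> g - 1) + {g}"


section \<open>Nets and subnets\<close>

text \<open>
  A net is a function on the carrier \<open>D\<close> of a directed preorder \<open>le\<close>; convergence of nets is
  convergence along the filter of tails. Subnets are Kelley subnets.
\<close>

definition directed_set :: "'i set \<Rightarrow> ('i \<Rightarrow> 'i \<Rightarrow> bool) \<Rightarrow> bool"
  where "directed_set D le \<longleftrightarrow>
    D \<noteq> {} \<and> reflp_on D le \<and> transp_on D le \<and> (\<forall>i\<in>D. \<forall>j\<in>D. \<exists>k\<in>D. le i k \<and> le j k)"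

definition tails :: "'i set \<Rightarrow> ('i \<Rightarrow> 'i \<Rightarrow> bool) \<Rightarrow> 'i filter"
  where "tails D le = (INF i\<in>D. principal {j\<in>D. le i j})"

lemma eventually_tails:
  assumes "directed_set D le"
  shows "eventually P (tails D le) \<longleftrightarrow> (\<exists>i\<in>D. \<forall>j\<in>D. le i j \<longrightarrow> P j)"
proof -
  have "eventually P (tails D le) \<longleftrightarrow> (\<exists>i\<in>D. eventually P (principal {j\<in>D. le i j}))"
    unfolding tails_def
  proof (rule eventually_INF_base)
    show "D \<noteq> {}" using assms by (simp add: directed_set_def)
  next
    fix i j assume ij: "i \<in> D" "j \<in> D"
    then obtain k where k: "k \<in> D" "le i k" "le j k"
      using assms unfolding directed_set_def by meson
    have "transp_on D le" using assms by (simp add: directed_set_def)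
    then have "{l\<in>D. le k l} \<subseteq> {l\<in>D. le i l} \<inter> {l\<in>D. le j l}"
      using ij k by (auto dest: transp_onD)
    then have "principal {l\<in>D. le k l} \<le> inf (principal {l\<in>D. le i l}) (principal {l\<in>D. le j l})"
      by simp
    then show "\<exists>k\<in>D. principal {l\<in>D. le k l} \<le> inf (principal {l\<in>D. le i l}) (principal {l\<in>D. le j l})"
      using k(1) by (rule rev_bexI[rotated])
  qed
  then show ?thesis by (simp add: eventually_principal Ball_def imp_conjL)
qed

definition subnet ::
    "'i set \<Rightarrow> ('i \<Rightarrow> 'i \<Rightarrow> bool) \<Rightarrow> 'k set \<Rightarrow> ('k \<Rightarrow> 'k \<Rightarrow> bool) \<Rightarrow> ('k \<Rightarrow> 'i) \<Rightarrow> bool"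
  where "subnet D le E le' \<phi> \<longleftrightarrow>
    directed_set E le' \<and> \<phi> ` E \<subseteq> D \<and> (\<forall>i\<in>D. \<exists>k\<^sub>0\<in>E. \<forall>k\<in>E. le' k\<^sub>0 k \<longrightarrow> le i (\<phi> k))"

text \<open>
  \<open>set_net_lim D le Y K\<close> is \<open>Y\<^sub>i \<rightharpoonup> K\<close>. HOL cannot quantify over the index type of the
  subnets inside a definition, so it is fixed as \<open>'i \<times> 'y set\<close>; by \<open>set_net_lim_any_index\<close> below
  subnets over other index types give nothing more.
\<close>

definition set_net_lim ::
    "'i set \<Rightarrow> ('i \<Rightarrow> 'i \<Rightarrow> bool) \<Rightarrow> ('i \<Rightarrow> 'y::topological_space set) \<Rightarrow> 'y set \<Rightarrow> bool"
  where "set_net_lim D le Y K \<longleftrightarrow>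
    K = {y. \<exists>(E :: ('i \<times> 'y set) set) le' \<phi> u. subnet D le E le' \<phi> \<and>
              (\<forall>k\<in>E. u k \<in> Y (\<phi> k)) \<and> (u \<longlongrightarrow> y) (tails E le')}"

lemma subnet_limit_frequently:
  assumes "subnet D le E le' \<phi>" and "\<forall>k\<in>E. u k \<in> Y (\<phi> k)" and "(u \<longlongrightarrow> y) (tails E le')"
    and "open U" and "y \<in> U" and "i \<in> D"
  shows "\<exists>j\<in>D. le i j \<and> Y j \<inter> U \<noteq> {}"
proof -
  have E: "directed_set E le'" using assms(1) by (simp add: subnet_def)
  have "eventually (\<lambda>k. u k \<in> U) (tails E le')"
    using assms(3-5) by (rule topological_tendstoD)
  then obtain a where a: "a \<in> E" "\<forall>k\<in>E. le' a k \<longrightarrow> u k \<in> U"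
    unfolding eventually_tails[OF E] by blast
  obtain b where b: "b \<in> E" "\<forall>k\<in>E. le' b k \<longrightarrow> le i (\<phi> k)"
    using assms(1,6) unfolding subnet_def by blast
  obtain k where k: "k \<in> E" "le' a k" "le' b k"
    using E a(1) b(1) unfolding directed_set_def by meson
  have "\<phi> k \<in> D" using assms(1) k(1) by (auto simp: subnet_def)
  moreover have "le i (\<phi> k)" using b(2) k by simp
  moreover have "u k \<in> Y (\<phi> k) \<inter> U" using a(2) k assms(2) by simp
  ultimately show ?thesis by blast
qed

lemma frequently_subnet_limit:
  fixes D :: "'i set" and Y :: "'i \<Rightarrow> 'y::topological_space set"
  assumes D: "directed_set D le"
    and freq: "\<And>U i. open U \<Longrightarrow> y \<in> U \<Longrightarrow> i \<in> D \<Longrightarrow> \<exists>j\<in>D. le i j \<and> Y j \<inter> U \<noteq> {}"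
  shows "\<exists>(E :: ('i \<times> 'y set) set) le' \<phi> u. subnet D le E le' \<phi> \<and>
           (\<forall>k\<in>E. u k \<in> Y (\<phi> k)) \<and> (u \<longlongrightarrow> y) (tails E le')"
proof -
  define E where "E = {(i, U). i \<in> D \<and> open U \<and> y \<in> U \<and> Y i \<inter> U \<noteq> {}}"
  define le' where "le' = (\<lambda>(i, U) (j, V). le i j \<and> V \<subseteq> (U :: 'y set))"
  define u where "u = (\<lambda>(i, U). SOME v. v \<in> Y i \<inter> U)"
  have u: "u (i, U) \<in> Y i \<inter> U" if "(i, U) \<in> E" for i U
    using that some_in_eq[of "Y i \<inter> U"] by (auto simp: E_def u_def)
  have refl: "le i i" if "i \<in> D" for i
    using D that by (auto simp: directed_set_def dest: reflp_onD)
  have trans: "le i k" if "i \<in> D" "j \<in> D" "k \<in> D" "le i j" "le j k" for i j k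
    using D that unfolding directed_set_def by (meson transp_onD)
  have mem: "\<exists>j. (j, U) \<in> E \<and> le i j" if "open U" "y \<in> U" "i \<in> D" for i U
    using freq[OF that] that by (auto simp: E_def)
  have E: "directed_set E le'"
    unfolding directed_set_def
  proof (intro conjI ballI)
    obtain i where "i \<in> D" using D by (auto simp: directed_set_def)
    then show "E \<noteq> {}" using mem[of UNIV i] by auto
    show "reflp_on E le'" by (auto simp: reflp_on_def E_def le'_def refl)
    show "transp_on E le'" by (auto simp: transp_on_def E_def le'_def intro: trans)
  next
    fix p q assume "p \<in> E" "q \<in> E"
    then obtain i U j V where pq: "p = (i, U)" "q = (j, V)" "i \<in> D" "j \<in> D"
      "open U" "open V" "y \<in> U" "y \<in> V" by (auto simp: E_def)
    obtain k where k: "k \<in> D" "le i k" "le j k"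
      using D pq unfolding directed_set_def by blast
    obtain l where l: "(l, U \<inter> V) \<in> E" "le k l"
      using mem[of "U \<inter> V" k] pq k by auto
    have "le i l" "le j l"
      using trans[of i k l] trans[of j k l] l k pq by (auto simp: E_def)
    then have "le' p (l, U \<inter> V) \<and> le' q (l, U \<inter> V)" by (auto simp: le'_def pq)
    then show "\<exists>r\<in>E. le' p r \<and> le' q r" using l(1) by blast
  qed
  have "subnet D le E le' fst"
    unfolding subnet_def
  proof (intro conjI E ballI)
    show "fst ` E \<subseteq> D" by (auto simp: E_def)
    fix i assume i: "i \<in> D"
    obtain j where j: "(j, UNIV) \<in> E" "le i j" using mem[of UNIV i] i by auto
    then have "\<forall>k\<in>E. le' (j, UNIV) k \<longrightarrow> le i (fst k)"
      using i trans[of i j] by (auto simp: E_def le'_def)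
    then show "\<exists>k\<^sub>0\<in>E. \<forall>k\<in>E. le' k\<^sub>0 k \<longrightarrow> le i (fst k)" using j(1) by blast
  qed
  moreover have "\<forall>k\<in>E. u k \<in> Y (fst k)" using u by auto
  moreover have "(u \<longlongrightarrow> y) (tails E le')"
  proof (rule topological_tendstoI)
    fix W assume W: "open W" "y \<in> W"
    obtain i where "i \<in> D" using D by (auto simp: directed_set_def)
    then obtain j where j: "(j, W) \<in> E" using mem[of W i] W by auto
    have "\<forall>k\<in>E. le' (j, W) k \<longrightarrow> u k \<in> W" using u by (fastforce simp: le'_def)
    then show "eventually (\<lambda>k. u k \<in> W) (tails E le')"
      unfolding eventually_tails[OF E] using j by blast
  qed
  ultimately show ?thesis by blast
qed

lemma set_net_lim_iff:
  assumes "directed_set D le"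
  shows "set_net_lim D le Y K \<longleftrightarrow>
    K = {y. \<forall>U. open U \<and> y \<in> U \<longrightarrow> (\<forall>i\<in>D. \<exists>j\<in>D. le i j \<and> Y j \<inter> U \<noteq> {})}"
    (is "_ \<longleftrightarrow> K = ?L")
proof -
  have "{y. \<exists>(E :: ('a \<times> 'b set) set) le' \<phi> u. subnet D le E le' \<phi> \<and>
              (\<forall>k\<in>E. u k \<in> Y (\<phi> k)) \<and> (u \<longlongrightarrow> y) (tails E le')} = ?L"
  proof (intro Collect_cong iffI)
    fix y
    assume "\<exists>(E :: ('a \<times> 'b set) set) le' \<phi> u. subnet D le E le' \<phi> \<and>
              (\<forall>k\<in>E. u k \<in> Y (\<phi> k)) \<and> (u \<longlongrightarrow> y) (tails E le')"
    then obtain E :: "('a \<times> 'b set) set" and le' \<phi> u where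
      "subnet D le E le' \<phi>" "\<forall>k\<in>E. u k \<in> Y (\<phi> k)" "(u \<longlongrightarrow> y) (tails E le')"
      by (elim exE conjE)
    note * = subnet_limit_frequently[OF this]
    show "\<forall>U. open U \<and> y \<in> U \<longrightarrow> (\<forall>i\<in>D. \<exists>j\<in>D. le i j \<and> Y j \<inter> U \<noteq> {})"
      by (intro allI impI ballI, elim conjE) (rule *)
  next
    fix y
    assume "\<forall>U. open U \<and> y \<in> U \<longrightarrow> (\<forall>i\<in>D. \<exists>j\<in>D. le i j \<and> Y j \<inter> U \<noteq> {})"
    then show "\<exists>(E :: ('a \<times> 'b set) set) le' \<phi> u. subnet D le E le' \<phi> \<and>
              (\<forall>k\<in>E. u k \<in> Y (\<phi> k)) \<and> (u \<longlongrightarrow> y) (tails E le')"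
      by (intro frequently_subnet_limit[OF assms]) simp
  qed
  then show ?thesis by (simp add: set_net_lim_def)
qed

lemma set_net_lim_any_index:
  assumes "directed_set D le" and "set_net_lim D le Y K"
    and "subnet D le E le' \<phi>" and "\<forall>k\<in>E. u k \<in> Y (\<phi> k)" and "(u \<longlongrightarrow> y) (tails E le')"
  shows "y \<in> K"
  using assms(2) subnet_limit_frequently[OF assms(3-5)]
  unfolding set_net_lim_iff[OF assms(1)] by simp


section \<open>Cones and recurrence\<close>

definition cone_along ::
    "'g::{group_add, topological_space} set \<Rightarrow> 'i set \<Rightarrow> ('i \<Rightarrow> 'i \<Rightarrow> bool) \<Rightarrow> ('i \<Rightarrow> 'g) \<Rightarrow> 'g set \<Rightarrow> bool"
  where "cone_along \<Gamma> D le g C \<longleftrightarrow>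
    directed_set D le \<and> (\<forall>i\<in>D. g i \<noteq> 0) \<and>
    filterlim (\<lambda>i. word_length \<Gamma> (g i)) at_top (tails D le) \<and>
    (\<forall>i\<in>D. \<forall>j\<in>D. le i j \<longrightarrow> word_length \<Gamma> (g i) \<le> word_length \<Gamma> (g j)) \<and>
    set_net_lim D le (\<lambda>i. cone_piece \<Gamma> (g i)) C"

text \<open>
  Again the index type of the nets has to be fixed; by \<open>is_cone_any_index\<close> below the choice
  \<open>'g set \<times> 'g\<close> is no restriction.
\<close>

definition is_cone :: "'g::{group_add, topological_space} set \<Rightarrow> 'g set \<Rightarrow> bool"
  where "is_cone \<Gamma> C \<longleftrightarrow> (\<exists>(D :: ('g set \<times> 'g) set) le g. cone_along \<Gamma> D le g C)"

lemma is_cone_any_index: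
  fixes \<Gamma> :: "'g::{group_add, topological_space} set"
  assumes "cone_along \<Gamma> D le g C"
  shows "is_cone \<Gamma> C"
proof -
  let ?w = "word_length \<Gamma>"
  have D: "directed_set D le" and nz: "\<forall>i\<in>D. g i \<noteq> 0"
    and lim: "filterlim (\<lambda>i. ?w (g i)) at_top (tails D le)"
    and mono: "\<And>i j. i \<in> D \<Longrightarrow> j \<in> D \<Longrightarrow> le i j \<Longrightarrow> ?w (g i) \<le> ?w (g j)"
    and C: "set_net_lim D le (\<lambda>i. cone_piece \<Gamma> (g i)) C"
    using assms by (auto simp: cone_along_def)
  define T where "T i = g ` {j\<in>D. le i j}" for i
  define D' where "D' = {(A, h). h \<in> A \<and> (\<exists>i\<in>D. A = T i)}"
  define le' where "le' = (\<lambda>(A, h) (B, k). B \<subseteq> (A :: 'g set) \<and> ?w h \<le> ?w k)"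
  have refl: "le i i" if "i \<in> D" for i
    using D that by (auto simp: directed_set_def dest: reflp_onD)
  have trans: "le i k" if "i \<in> D" "j \<in> D" "k \<in> D" "le i j" "le j k" for i j k
    using D that unfolding directed_set_def by (meson transp_onD)
  have T_mono: "T j \<subseteq> T i" if "i \<in> D" "j \<in> D" "le i j" for i j
    using that by (auto simp: T_def intro!: imageI trans[of i j])
  have T_self: "(T i, g i) \<in> D'" if "i \<in> D" for i
    using that refl by (auto simp: D'_def T_def)
  have large: "\<exists>k\<in>D. le i k \<and> le j k \<and> n \<le> ?w (g k)" if ij: "i \<in> D" "j \<in> D" for i j n
  proof -
    have "eventually (\<lambda>i. n \<le> ?w (g i)) (tails D le)"
      using lim by (simp add: filterlim_at_top)
    then obtain a where a: "a \<in> D" "\<forall>j\<in>D. le a j \<longrightarrow> n \<le> ?w (g j)"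
      unfolding eventually_tails[OF D] by blast
    obtain b where b: "b \<in> D" "le i b" "le j b"
      using D ij unfolding directed_set_def by meson
    obtain k where k: "k \<in> D" "le a k" "le b k"
      using D a(1) b(1) unfolding directed_set_def by meson
    have "le i k" "le j k"
      using trans[of i b k] trans[of j b k] ij b k by simp_all
    then show ?thesis using a(2) k by blast
  qed
  have D': "directed_set D' le'"
    unfolding directed_set_def
  proof (intro conjI ballI)
    obtain i where "i \<in> D" using D by (auto simp: directed_set_def)
    then show "D' \<noteq> {}" using T_self by blast
    show "reflp_on D' le'" by (auto simp: reflp_on_def le'_def)
    show "transp_on D' le'" by (auto simp: transp_on_def le'_def)
  next
    fix p q assume "p \<in> D'" "q \<in> D'"
    then obtain i j h k where pq: "p = (T i, h)" "q = (T j, k)" "i \<in> D" "j \<in> D"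
      by (auto simp: D'_def)
    obtain l where l: "l \<in> D" "le i l" "le j l" "max (?w h) (?w k) \<le> ?w (g l)"
      using large[OF pq(3,4)] by blast
    then have "le' p (T l, g l) \<and> le' q (T l, g l)"
      using T_mono[of i l] T_mono[of j l] pq by (auto simp: le'_def)
    then show "\<exists>r\<in>D'. le' p r \<and> le' q r" using T_self[OF l(1)] by blast
  qed
  have above: "\<exists>j\<in>D. le i j \<and> h = g j" if "(A, h) \<in> D'" "A \<subseteq> T i" for A h i
    using that by (auto simp: D'_def T_def)
  have *: "(\<forall>i\<in>D. \<exists>j\<in>D. le i j \<and> P (g j)) \<longleftrightarrow> (\<forall>p\<in>D'. \<exists>q\<in>D'. le' p q \<and> P (snd q))" for P
  proof (intro iffI ballI)
    fix p assume P: "\<forall>i\<in>D. \<exists>j\<in>D. le i j \<and> P (g j)" and "p \<in> D'"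
    then obtain i h where p: "p = (T i, h)" "i \<in> D" by (auto simp: D'_def)
    obtain k where k: "k \<in> D" "le i k" "?w h \<le> ?w (g k)" using large[of i i] p by blast
    obtain j where j: "j \<in> D" "le k j" "P (g j)" using P k by blast
    have "le' p (T j, g j)"
      using T_mono[of i j] trans[of i k j] mono[of k j] j k p by (auto simp: le'_def)
    then show "\<exists>q\<in>D'. le' p q \<and> P (snd q)" using T_self[OF j(1)] j(3) by force
  next
    fix i assume P: "\<forall>p\<in>D'. \<exists>q\<in>D'. le' p q \<and> P (snd q)" and "i \<in> D"
    then obtain q where q: "q \<in> D'" "le' (T i, g i) q" "P (snd q)" using T_self by blast
    then show "\<exists>j\<in>D. le i j \<and> P (g j)"
      using above[of "fst q" "snd q" i] by (auto simp: le'_def split: prod.splits)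
  qed
  have "filterlim (\<lambda>p. ?w (snd p)) at_top (tails D' le')"
    unfolding filterlim_at_top
  proof
    fix n
    obtain i where "i \<in> D" using D by (auto simp: directed_set_def)
    then obtain k where k: "k \<in> D" "n \<le> ?w (g k)" using large by blast
    have "\<forall>q\<in>D'. le' (T k, g k) q \<longrightarrow> n \<le> ?w (snd q)" using k by (auto simp: le'_def)
    then show "eventually (\<lambda>p. n \<le> ?w (snd p)) (tails D' le')"
      unfolding eventually_tails[OF D'] using T_self[OF k(1)] by blast
  qed
  moreover have "\<forall>p\<in>D'. snd p \<noteq> 0" using nz by (auto simp: D'_def T_def)
  moreover have "\<forall>p\<in>D'. \<forall>q\<in>D'. le' p q \<longrightarrow> ?w (snd p) \<le> ?w (snd q)" by (auto simp: le'_def)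
  moreover have "set_net_lim D' le' (\<lambda>p. cone_piece \<Gamma> (snd p)) C"
    using C *[of "\<lambda>h. cone_piece \<Gamma> h \<inter> U \<noteq> {}" for U]
    unfolding set_net_lim_iff[OF D] set_net_lim_iff[OF D'] by simp
  ultimately have "cone_along \<Gamma> D' le' snd C" using D' by (simp add: cone_along_def)
  then show ?thesis unfolding is_cone_def by blast
qed

text \<open>The sets involved in the definition of a cone are automatically members of \<open>2\<^sup>G\<close>.\<close>

lemma closed_cone_piece:
  fixes \<Gamma> :: "'g::{group_add, topological_monoid_add, t2_space} set"
  assumes "compact \<Gamma>"
  shows "closed (cone_piece \<Gamma> g)"
proof -
  have plus: "compact (A + B)" if "compact A" "compact B" for A B :: "'g set"
  proof -
    have "A + B = (\<lambda>p. fst p + snd p) ` (A \<times> B)" by (force simp: set_plus_def)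
    moreover have "continuous_on (A \<times> B) (\<lambda>p. fst p + snd p)" by (intro continuous_intros)
    ultimately show ?thesis using compact_Times[OF that] by (simp add: compact_continuous_image)
  qed
  have "compact (sumset_power \<Gamma> r)" for r
    by (induction r) (auto intro: plus assms)
  then show ?thesis unfolding cone_piece_def by (intro compact_imp_closed plus) auto
qed

lemma closed_set_net_lim:
  assumes "directed_set D le" and "set_net_lim D le Y K"
  shows "closed K"
proof -
  have "- K = \<Union>{U. open U \<and> (\<exists>i\<in>D. \<forall>j\<in>D. le i j \<longrightarrow> Y j \<inter> U = {})}"
    using assms(2) unfolding set_net_lim_iff[OF assms(1)] by blast
  then have "open (- K)" by auto
  then show ?thesis by (simp add: closed_def)
qed

definition recurrent_type_I ::
    "'g::{group_add, topological_space} set \<Rightarrow> ('g \<Rightarrow> 'z::topological_space \<Rightarrow> 'z) \<Rightarrow> 'z \<Rightarrow> bool"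
  where "recurrent_type_I \<Gamma> act z \<longleftrightarrow>
    (\<forall>C U. is_cone \<Gamma> C \<and> open U \<and> z \<in> U \<longrightarrow> (\<lambda>c. act c z) ` C \<inter> U \<noteq> {})"

definition pointwise_product_recurrent_type_I ::
    "'g::{group_add, topological_space} set \<Rightarrow> ('g \<Rightarrow> 'x::topological_space \<Rightarrow> 'x) \<Rightarrow> bool"
  where "pointwise_product_recurrent_type_I \<Gamma> act \<longleftrightarrow>
    (\<forall>p. recurrent_type_I \<Gamma> (prod_act act) p)"

end

theory Submission
  imports Defs
begin

text \<open>
  Recurrence implies equicontinuity: given an entourage \<open>\<epsilon>\<close>, choose a compact open \<open>U \<subseteq> \<epsilon>\<close>
  containing the orbit closure of \<open>(x, x)\<close> in the product. If points arbitrarily near \<open>(x, x)\<close>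
  leave \<open>U\<close>, their first exits accumulate at a point outside \<open>U\<close> that some cone maps into \<open>U\<close>;
  hence all orbits starting near \<open>(x, x)\<close> stay in \<open>U\<close>.

  Equicontinuity implies distality by moving a pair of nearby points back with the inverse.

  Distality implies recurrence: by Ellis, the enveloping semigroup of a distal flow is a group, so
  orbit closures in the product are minimal. Finitely many elements, hence some \<open>\<Gamma>\<^sup>r\<close>, then move
  every point of the orbit closure of \<open>z\<close> into a given neighbourhood of \<open>z\<close>; and each cone contains
  a translate \<open>\<Gamma>\<^sup>r h\<close>.
\<close>

section \<open>Word length\<close>

lemma sumset_power_add: "sumset_power \<Gamma> (m + n) = sumset_power \<Gamma> m + sumset_power \<Gamma> n"
proof (induction n)
  case 0
  show ?case by (simp add: set_plus_def)
next
  case (Suc n)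
  then show ?case by (simp add: add.assoc)
qed

lemma sumset_power_mono:
  assumes "0 \<in> \<Gamma>" "m \<le> n"
  shows "sumset_power \<Gamma> m \<subseteq> sumset_power \<Gamma> n"
proof (rule lift_Suc_mono_le[OF _ \<open>m \<le> n\<close>])
  fix k
  show "sumset_power \<Gamma> k \<subseteq> sumset_power \<Gamma> (Suc k)"
    using set_plus_intro[OF _ \<open>0 \<in> \<Gamma>\<close>, of _ "sumset_power \<Gamma> k"] by fastforce
qed

lemma compact_set_plus:
  fixes A B :: "'g::topological_monoid_add set"
  assumes "compact A" "compact B"
  shows "compact (A + B)"
proof -
  have "A + B = (\<lambda>p. fst p + snd p) ` (A \<times> B)" by (force simp: set_plus_def)
  moreover have "continuous_on (A \<times> B) (\<lambda>p. fst p + snd p)" by (intro continuous_intros)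
  ultimately show ?thesis using compact_Times[OF assms] by (simp add: compact_continuous_image)
qed

lemma compact_sumset_power:
  fixes \<Gamma> :: "'g::{group_add, topological_monoid_add} set"
  assumes "compact \<Gamma>"
  shows "compact (sumset_power \<Gamma> r)"
  by (induction r) (auto intro: compact_set_plus assms)

text \<open>Inverting a word reverses it: the last letter of \<open>g\<close> becomes the first
  letter of \<open>- g\<close>. As \<open>sumset_power\<close> appends letters on the right, the
  induction step splits the power as \<open>1 + r\<close>.\<close>

lemma sumset_power_uminus:
  assumes "uminus ` \<Gamma> = \<Gamma>" "g \<in> sumset_power \<Gamma> r"
  shows "- g \<in> sumset_power \<Gamma> r"
  using assms(2)
proof (induction r arbitrary: g)
  case (Suc r)
  then obtain h a where g: "g = h + a" "h \<in> sumset_power \<Gamma> r" "a \<in> \<Gamma>"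
    by (auto elim: set_plus_elim)
  have "- a \<in> sumset_power \<Gamma> 1"
    using g(3) assms(1) by (force simp: set_plus_def)
  then have "- a + - h \<in> sumset_power \<Gamma> (1 + r)"
    unfolding sumset_power_add by (rule set_plus_intro) (rule Suc.IH[OF g(2)])
  then show ?case by (simp add: g(1) minus_add)
qed simp

context
  fixes \<Gamma> :: "'g::{group_add, topological_space} set"
  assumes generated: "compactly_generated_by \<Gamma>"
begin

text \<open>Since \<open>0 \<in> \<Gamma>\<close>, the powers increase, so the least exponent
  decides membership; the powers can then be handled as balls for the word length.\<close>

lemma sumset_power_iff_word_length: "g \<in> sumset_power \<Gamma> r \<longleftrightarrow> word_length \<Gamma> g \<le> r"
proof
  assume "g \<in> sumset_power \<Gamma> r"
  then show "word_length \<Gamma> g \<le> r" unfolding word_length_def by (rule Least_le)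
next
  assume *: "word_length \<Gamma> g \<le> r"
  obtain n where "g \<in> sumset_power \<Gamma> n"
    using generated unfolding compactly_generated_by_def by blast
  then have "g \<in> sumset_power \<Gamma> (word_length \<Gamma> g)" unfolding word_length_def by (rule LeastI)
  then show "g \<in> sumset_power \<Gamma> r"
    using sumset_power_mono[OF _ *] generated by (auto simp: compactly_generated_by_def)
qed

lemma word_length_uminus: "word_length \<Gamma> (- g) = word_length \<Gamma> g"
proof -
  have *: "word_length \<Gamma> (- h) \<le> word_length \<Gamma> h" for h
    using sumset_power_uminus[of \<Gamma> h "word_length \<Gamma> h"] generated
    by (simp add: sumset_power_iff_word_length compactly_generated_by_def)
  show ?thesis using *[of g] *[of "- g"] by simp
qed

lemma word_length_eq_0_iff: "word_length \<Gamma> g = 0 \<longleftrightarrow> g = 0"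
  using sumset_power_iff_word_length[of g 0] by simp

end


section \<open>Cones\<close>

text \<open>Turns a filter of long group elements into a cone. The net consists of pairs
  \<open>(A, h)\<close> with \<open>h\<close> in the \<open>F\<close>-large set \<open>A\<close>,
  ordered by reverse inclusion; comparing lengths as well builds in the monotonicity that cones
  require.\<close>

lemma is_cone_of_filter:
  fixes \<Gamma> :: "'g::{group_add, topological_space} set"
  assumes generated: "compactly_generated_by \<Gamma>"
    and F: "F \<noteq> bot" and long: "filterlim (word_length \<Gamma>) at_top F"
  shows "is_cone \<Gamma> {y. \<forall>U. open U \<and> y \<in> U \<longrightarrow> (\<exists>\<^sub>F g in F. cone_piece \<Gamma> g \<inter> U \<noteq> {})}"
    (is "is_cone \<Gamma> ?C")
proof -
  let ?w = "word_length \<Gamma>"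
  define D where "D = {(A, h). (\<forall>\<^sub>F g in F. g \<in> A) \<and> h \<in> A \<and> h \<noteq> 0}"
  define le where "le = (\<lambda>(A, h) (B, k). B \<subseteq> (A :: 'g set) \<and> ?w h \<le> ?w k)"
  have pick: "\<exists>k\<in>A. k \<noteq> 0 \<and> n \<le> ?w k \<and> P k" if "\<forall>\<^sub>F g in F. g \<in> A" "\<exists>\<^sub>F g in F. P g" for A n P
  proof -
    \<comment> \<open>The bound \<open>max 1 n\<close> also forces \<open>k \<noteq> 0\<close>,
      since only \<open>0\<close> has length \<open>0\<close>.\<close>
    have "\<forall>\<^sub>F g in F. max 1 n \<le> ?w g" using long by (simp only: filterlim_at_top)
    then have "\<forall>\<^sub>F g in F. g \<in> A \<and> max 1 n \<le> ?w g" using that(1) by (rule eventually_conj[rotated])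
    from frequently_eventually_conj[OF that(2) this]
    obtain k where "k \<in> A" "max 1 n \<le> ?w k" "P k" by (auto dest: frequently_ex)
    moreover have "k \<noteq> 0"
      using word_length_eq_0_iff[OF generated, of k] \<open>max 1 n \<le> ?w k\<close> by auto
    ultimately show ?thesis by auto
  qed
  have D: "directed_set D le"
    unfolding directed_set_def
  proof (intro conjI ballI)
    obtain k where "k \<noteq> (0 :: 'g)" using pick[of UNIV "\<lambda>_. True"] F by auto
    then have "(UNIV, k) \<in> D" by (simp add: D_def)
    then show "D \<noteq> {}" by blast
    show "reflp_on D le" by (auto simp: reflp_on_def le_def)
    show "transp_on D le" by (auto simp: transp_on_def le_def)
  next
    fix p q assume "p \<in> D" "q \<in> D"
    then obtain A h B k where pq: "p = (A, h)" "q = (B, k)" and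
      ev: "\<forall>\<^sub>F g in F. g \<in> A" "\<forall>\<^sub>F g in F. g \<in> B" by (auto simp: D_def)
    have ev': "\<forall>\<^sub>F g in F. g \<in> A \<inter> B" using eventually_conj[OF ev] by simp
    obtain l where "l \<in> A \<inter> B" "l \<noteq> 0" "max (?w h) (?w k) \<le> ?w l"
      using pick[OF ev', of "\<lambda>_. True" "max (?w h) (?w k)"] F by auto
    then have "(A \<inter> B, l) \<in> D \<and> le p (A \<inter> B, l) \<and> le q (A \<inter> B, l)"
      using ev' by (auto simp: D_def le_def pq)
    then show "\<exists>r\<in>D. le p r \<and> le q r" by blast
  qed
  \<comment> \<open>Cofinal occurrence along the net amounts to frequent occurrence in
    \<open>F\<close>; this identifies the limit of the cone pieces with \<open>?C\<close>.\<close>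
  have freq: "(\<forall>p\<in>D. \<exists>q\<in>D. le p q \<and> P (snd q)) \<longleftrightarrow> (\<exists>\<^sub>F g in F. P g)" for P
  proof
    assume P: "\<exists>\<^sub>F g in F. P g"
    show "\<forall>p\<in>D. \<exists>q\<in>D. le p q \<and> P (snd q)"
    proof
      fix p assume "p \<in> D"
      then obtain A h where p: "p = (A, h)" and A: "\<forall>\<^sub>F g in F. g \<in> A" by (auto simp: D_def)
      obtain k where "k \<in> A" "k \<noteq> 0" "?w h \<le> ?w k" "P k" using pick[OF A P] by blast
      then have "(A, k) \<in> D \<and> le p (A, k) \<and> P (snd (A, k))"
        using A by (auto simp: D_def le_def p)
      then show "\<exists>q\<in>D. le p q \<and> P (snd q)" by blast
    qed
  next
    assume P: "\<forall>p\<in>D. \<exists>q\<in>D. le p q \<and> P (snd q)"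
    show "\<exists>\<^sub>F g in F. P g"
    proof (rule ccontr)
      assume "\<not> ?thesis"
      \<comment> \<open>The set of failures of \<open>P\<close> is used as the first component of an
        index; all later indices have their group element in it.\<close>
      then have ev: "\<forall>\<^sub>F g in F. g \<in> {g. \<not> P g}" by (simp add: not_frequently)
      then obtain k where "k \<in> {g. \<not> P g}" "k \<noteq> 0" using pick[OF ev, of "\<lambda>_. True"] F by auto
      then have "({g. \<not> P g}, k) \<in> D" using ev by (simp add: D_def)
      then obtain q where "q \<in> D" "le ({g. \<not> P g}, k) q" "P (snd q)" using P by blast
      then show False by (auto simp: D_def le_def)
    qed
  qed
  have "filterlim (\<lambda>p. ?w (snd p)) at_top (tails D le)"
    unfolding filterlim_at_top
  proof
    fix n
    obtain k where "k \<noteq> 0" "n \<le> ?w k" using pick[of UNIV "\<lambda>_. True"] F by auto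
    then have "(UNIV, k) \<in> D" "\<forall>q\<in>D. le (UNIV, k) q \<longrightarrow> n \<le> ?w (snd q)"
      by (auto simp: D_def le_def)
    then show "\<forall>\<^sub>F p in tails D le. n \<le> ?w (snd p)" unfolding eventually_tails[OF D] by blast
  qed
  moreover have "\<forall>p\<in>D. snd p \<noteq> 0" by (auto simp: D_def)
  moreover have "\<forall>p\<in>D. \<forall>q\<in>D. le p q \<longrightarrow> ?w (snd p) \<le> ?w (snd q)" by (auto simp: le_def)
  moreover have "set_net_lim D le (\<lambda>p. cone_piece \<Gamma> (snd p)) ?C"
    unfolding set_net_lim_iff[OF D] using freq[of "\<lambda>g. cone_piece \<Gamma> g \<inter> U \<noteq> {}" for U] by simp
  ultimately have "cone_along \<Gamma> D le snd ?C" using D by (simp add: cone_along_def)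
  then show ?thesis by (rule is_cone_any_index)
qed

text \<open>Split off the last \<open>Suc r\<close> letters, \<open>g = a + h\<close>. For
  \<open>t\<close> in the \<open>r\<close>-th power, \<open>t + h\<close> equals
  \<open>t + - a + g\<close>, and \<open>t + - a\<close> has length at most \<open>r + m\<close>,
  one less than the length of \<open>g\<close>. The power containing \<open>h\<close> does not
  depend on \<open>g\<close>, which makes a passage to the limit possible.\<close>

lemma translate_subset_cone_piece:
  assumes generated: "compactly_generated_by \<Gamma>" and "r < word_length \<Gamma> g"
  shows "\<exists>h\<in>sumset_power \<Gamma> (Suc r). sumset_power \<Gamma> r + {h} \<subseteq> cone_piece \<Gamma> g"
proof -
  define m where "m = word_length \<Gamma> g - Suc r"
  have w: "word_length \<Gamma> g = m + Suc r" using assms(2) by (simp add: m_def)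
  have "g \<in> sumset_power \<Gamma> (m + Suc r)"
    by (simp only: w sumset_power_iff_word_length[OF generated])
  then obtain a h where ah: "g = a + h" "a \<in> sumset_power \<Gamma> m" "h \<in> sumset_power \<Gamma> (Suc r)"
    unfolding sumset_power_add by (rule set_plus_elim)
  have "t + h \<in> cone_piece \<Gamma> g" if "t \<in> sumset_power \<Gamma> r" for t
  proof -
    have "- a \<in> sumset_power \<Gamma> m"
      using sumset_power_uminus[OF _ ah(2)] generated by (simp add: compactly_generated_by_def)
    then have "t + - a \<in> sumset_power \<Gamma> (r + m)"
      unfolding sumset_power_add using that by (rule set_plus_intro[rotated])
    then have "t + - a + g \<in> cone_piece \<Gamma> g"
      unfolding cone_piece_def by (intro set_plus_intro) (simp_all add: w add.commute)
    then show ?thesis by (metis ah(1) add.assoc minus_add_cancel)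
  qed
  then show ?thesis using ah(3) by (auto elim!: set_plus_elim)
qed

text \<open>The elements \<open>h i\<close> obtained from the pieces of the net eventually lie in
  one compact power, so they cluster at some \<open>k\<close>. By continuity of left translation,
  \<open>t + k\<close> is a cluster point of the elements \<open>t + h i\<close> of the pieces,
  hence lies in \<open>C\<close>.\<close>

lemma translate_subset_cone:
  fixes \<Gamma> :: "'g::{group_add, topological_monoid_add} set"
  assumes generated: "compactly_generated_by \<Gamma>" and "is_cone \<Gamma> C"
  shows "\<exists>h. sumset_power \<Gamma> r + {h} \<subseteq> C"
proof -
  obtain D :: "('g set \<times> 'g) set" and le g where "cone_along \<Gamma> D le g C"
    using assms(2) by (auto simp: is_cone_def)
  then have D: "directed_set D le"
    and long: "filterlim (\<lambda>i. word_length \<Gamma> (g i)) at_top (tails D le)"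
    and C: "set_net_lim D le (\<lambda>i. cone_piece \<Gamma> (g i)) C"
    by (auto simp: cone_along_def)
  have freq_tails: "(\<exists>\<^sub>F i in tails D le. P i) \<longleftrightarrow> (\<forall>i\<in>D. \<exists>j\<in>D. le i j \<and> P j)" for P
    unfolding frequently_def eventually_tails[OF D] by blast
  have "\<exists>i. i \<in> D" using D by (auto simp: directed_set_def)
  then have nontriv: "tails D le \<noteq> bot"
    using D unfolding trivial_limit_def eventually_tails[OF D]
    by (auto simp: directed_set_def dest: reflp_onD)
  define good where "good i h \<longleftrightarrow> h \<in> sumset_power \<Gamma> (Suc r) \<and>
    sumset_power \<Gamma> r + {h} \<subseteq> cone_piece \<Gamma> (g i)" for i h
  \<comment> \<open>The choice is meaningful only eventually, once \<open>g i\<close> is longer than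
    \<open>r\<close>.\<close>
  define h where "h i = (SOME h. good i h)" for i
  have "\<forall>\<^sub>F i in tails D le. Suc r \<le> word_length \<Gamma> (g i)"
    using long by (simp only: filterlim_at_top)
  then have h: "\<forall>\<^sub>F i in tails D le. good i (h i)"
  proof eventually_elim
    case (elim i)
    then have "\<exists>h. good i h" using translate_subset_cone_piece[OF generated, of r "g i"]
      by (auto simp: good_def)
    then show ?case unfolding h_def by (rule someI_ex)
  qed
  define F where "F = filtermap h (tails D le)"
  have "F \<noteq> bot" using nontriv by (simp add: F_def filtermap_bot_iff)
  moreover have "\<forall>\<^sub>F x in F. x \<in> sumset_power \<Gamma> (Suc r)"
    using h unfolding F_def eventually_filtermap by (auto simp: good_def elim: eventually_mono)
  moreover have "compact (sumset_power \<Gamma> (Suc r))"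
    using generated by (intro compact_sumset_power) (simp add: compactly_generated_by_def)
  ultimately obtain k where k: "inf (nhds k) F \<noteq> bot" unfolding compact_filter by blast
  have "t + k \<in> C" if t: "t \<in> sumset_power \<Gamma> r" for t
  proof -
    have "\<exists>j\<in>D. le i j \<and> cone_piece \<Gamma> (g j) \<inter> U \<noteq> {}"
      if U: "open U" "t + k \<in> U" and i: "i \<in> D" for U i
    proof -
      have cont: "continuous_on UNIV ((+) t)" by (intro continuous_intros)
      have "open ((+) t -` U)" using open_vimage[OF U(1) cont] .
      then have "\<forall>\<^sub>F x in nhds k. t + x \<in> U"
        using U(2) by (auto simp: eventually_nhds)
      then have "\<exists>\<^sub>F x in F. t + x \<in> U"
        using k unfolding frequently_def trivial_limit_def eventually_inf by (metis (mono_tags, lifting))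
      then have "\<exists>\<^sub>F i in tails D le. t + h i \<in> U" by (simp add: F_def frequently_filtermap)
      from frequently_eventually_conj[OF this h]
      have "\<exists>\<^sub>F i in tails D le. cone_piece \<Gamma> (g i) \<inter> U \<noteq> {}"
        using t by (elim frequently_elim1) (auto simp: good_def set_plus_def)
      then show ?thesis using i by (simp add: freq_tails)
    qed
    then show ?thesis using C unfolding set_net_lim_iff[OF D] by blast
  qed
  then show ?thesis by (auto elim!: set_plus_elim)
qed


section \<open>Continuous actions\<close>

locale continuous_action =
  fixes act :: "'g::{group_add, topological_monoid_add, t2_space} \<Rightarrow> 'z::t2_space \<Rightarrow> 'z"
  assumes continuous_act: "continuous_on UNIV (\<lambda>(t, x). act t x)"
    and act_zero [simp]: "act 0 x = x"
    and act_add: "act (s + t) x = act s (act t x)"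
begin

section \<open>Consequences of joint continuity\<close>

lemma act_uminus_cancel [simp]: "act (- g) (act g x) = x"
  using act_add[of "- g" g x] by simp

lemma continuous_on_act: "continuous_on UNIV (act g)"
proof -
  have "continuous_on UNIV (\<lambda>x. (\<lambda>(t, x). act t x) (g, x))"
    by (rule continuous_on_compose2[OF continuous_act]) (auto intro!: continuous_intros)
  then show ?thesis by simp
qed

lemma open_act_vimage:
  assumes "open U"
  shows "open {p. act (fst p) (snd p) \<in> U}"
  using open_vimage[OF assms continuous_act] by (simp add: vimage_def case_prod_unfold)

lemma compact_act_image:
  assumes "compact K" "compact U"
  shows "compact {act g x | g x. g \<in> K \<and> x \<in> U}"
proof -
  have "{act g x | g x. g \<in> K \<and> x \<in> U} = (\<lambda>(t, x). act t x) ` (K \<times> U)" by auto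
  then show ?thesis
    using compact_continuous_image[OF continuous_on_subset[OF continuous_act] compact_Times[OF assms]]
    by simp
qed

lemma compact_set_keeps_in_open:
  assumes "compact K" "open U" "\<And>g. g \<in> K \<Longrightarrow> act g z \<in> U"
  shows "\<exists>V. open V \<and> z \<in> V \<and> (\<forall>v\<in>V. \<forall>g\<in>K. act g v \<in> U)"
proof -
  \<comment> \<open>The coordinates are swapped because the tube lemma takes the compact factor in
    second place.\<close>
  have "continuous_on UNIV (\<lambda>p. (\<lambda>(t, x). act t x) (prod.swap p))"
    by (rule continuous_on_compose2[OF continuous_act]) (auto intro!: continuous_on_swap)
  from open_vimage[OF assms(2) this] have "open {p. act (snd p) (fst p) \<in> U}"
    by (simp add: vimage_def prod.swap_def)
  moreover have "{z} \<times> K \<subseteq> {p. act (snd p) (fst p) \<in> U}" using assms(3) by auto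
  ultimately show ?thesis using Elementary_Topology.tube_lemma[OF assms(1)] by fastforce
qed

text \<open>
  If the orbits of points \<open>v\<close> near \<open>z\<close> left \<open>U\<close>, let \<open>g\<close> be a shortest element with
  \<open>act g v \<notin> U\<close>. Then \<open>cone_piece \<Gamma> (- g)\<close> moves \<open>act g v\<close> back into \<open>U\<close>, the lengths of the
  \<open>g\<close> are unbounded as \<open>v\<close> tends to \<open>z\<close>, and the points \<open>act g v\<close> stay in the compact set
  \<open>\<Gamma>U - U\<close>. So the limiting cone maps a cluster point of them into \<open>U\<close>, and that point is not
  recurrent.
\<close>

lemma orbits_near_stay_in_compact_open:
  assumes generated: "compactly_generated_by \<Gamma>"
    and U: "compact U" "open U"
    and orbit: "\<And>g. act g z \<in> U"
    and recurrent: "\<And>w. recurrent_type_I \<Gamma> act w"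
  shows "\<exists>V. open V \<and> z \<in> V \<and> (\<forall>v\<in>V. \<forall>g. act g v \<in> U)"
proof (rule ccontr)
  assume leave: "\<not> ?thesis"
  let ?w = "word_length \<Gamma>"
  have cpt: "compact \<Gamma>" and sym: "uminus ` \<Gamma> = \<Gamma>"
    using generated by (auto simp: compactly_generated_by_def)
  \<comment> \<open>\<open>B\<close> collects the pairs of a point and a shortest element moving it
    out of \<open>U\<close>; \<open>F\<close> describes such pairs as the point tends to
    \<open>z\<close>.\<close>
  define B where "B = {(v, g). act g v \<notin> U \<and> (\<forall>h. ?w h < ?w g \<longrightarrow> act h v \<in> U)}"
  define F where "F = inf (filtercomap fst (nhds z)) (principal B)"
  have evF: "(\<forall>\<^sub>F p in F. P p) \<longleftrightarrow> (\<exists>V. open V \<and> z \<in> V \<and> (\<forall>p\<in>B. fst p \<in> V \<longrightarrow> P p))" for P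
    unfolding F_def eventually_inf_principal eventually_filtercomap_nhds by fastforce
  have F: "F \<noteq> bot"
    unfolding trivial_limit_def evF
  proof (safe, simp)
    fix V assume V: "open V" "z \<in> V" "\<forall>p\<in>B. fst p \<notin> V"
    obtain v g where v: "v \<in> V" "act g v \<notin> U" using leave V(1,2) by blast
    obtain h where "act h v \<notin> U" "\<forall>k. act k v \<notin> U \<longrightarrow> ?w h \<le> ?w k"
      using ex_has_least_nat[of "\<lambda>g. act g v \<notin> U" g ?w] v(2) by blast
    then have "(v, h) \<in> B" by (force simp: B_def)
    then show False using V v(1) by force
  qed
  have B: "\<forall>\<^sub>F p in F. p \<in> B" unfolding evF using open_UNIV by blast
  have long: "\<forall>\<^sub>F p in F. n \<le> ?w (snd p)" for n
  proof -
    \<comment> \<open>Near \<open>z\<close> the whole \<open>n\<close>-th power keeps points in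
      \<open>U\<close>, so leaving \<open>U\<close> from there takes more than \<open>n\<close>
      letters.\<close>
    obtain V where V: "open V" "z \<in> V" "\<forall>v\<in>V. \<forall>g\<in>sumset_power \<Gamma> n. act g v \<in> U"
      using compact_set_keeps_in_open[OF compact_sumset_power[OF cpt] U(2) orbit] by blast
    have "n \<le> ?w (snd p)" if "p \<in> B" "fst p \<in> V" for p
      using V(3) that sumset_power_iff_word_length[OF generated, of "snd p" n]
      by (force simp: B_def)
    then show ?thesis unfolding evF using V by blast
  qed
  define e where "e p = act (snd p) (fst p)" for p
  define K where "K = {act a x | a x. a \<in> \<Gamma> \<and> x \<in> U} - U"
  have "\<forall>\<^sub>F p in F. e p \<in> K"
    using B long[of 1]
  proof eventually_elim
    case (elim p)
    obtain v g where p: "p = (v, g)" by force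
    have g: "act g v \<notin> U" "\<And>h. ?w h < ?w g \<Longrightarrow> act h v \<in> U" "1 \<le> ?w g"
      using elim by (auto simp: p B_def)
    \<comment> \<open>Splitting \<open>- g\<close> instead of \<open>g\<close> isolates the letter
      that acts last: in \<open>g = - a + - h\<close> the shorter \<open>- h\<close> still keeps
      \<open>v\<close> in \<open>U\<close>, and the single generator \<open>- a\<close> takes it
      out.\<close>
    have "- g \<in> sumset_power \<Gamma> (Suc (?w g - 1))"
      using g(3) by (simp only: sumset_power_iff_word_length[OF generated]
        word_length_uminus[OF generated])
    then obtain h a where ha: "- g = h + a" "h \<in> sumset_power \<Gamma> (?w g - 1)" "a \<in> \<Gamma>"
      by (auto elim: set_plus_elim)
    have "g = - a + - h" using ha(1) by (metis minus_add minus_minus)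
    moreover have "act (- h) v \<in> U"
      using ha(2) g(3) by (intro g(2))
        (simp add: sumset_power_iff_word_length[OF generated] word_length_uminus[OF generated])
    moreover have "- a \<in> \<Gamma>" using ha(3) sym by blast
    moreover have "act g v = act (- a) (act (- h) v)"
      unfolding \<open>g = - a + - h\<close> by (rule act_add)
    ultimately show ?case using g(1) by (auto simp: K_def e_def p)
  qed
  then have evK: "\<forall>\<^sub>F w in filtermap e F. w \<in> K" by (simp add: eventually_filtermap)
  have "compact K" unfolding K_def
    by (rule compact_diff[OF compact_act_image[OF cpt U(1)] U(2)])
  moreover have "filtermap e F \<noteq> bot" using F by (simp add: filtermap_bot_iff)
  ultimately obtain w where w: "w \<in> K" "inf (nhds w) (filtermap e F) \<noteq> bot"
    using evK unfolding compact_filter by blast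
  \<comment> \<open>\<open>F'\<close> refines \<open>F\<close> so that the exit points
    \<open>e p\<close> converge to \<open>w\<close>.\<close>
  define F' where "F' = inf (filtercomap e (nhds w)) F"
  have evF': "\<forall>\<^sub>F p in F'. e p \<in> M" if "open M" "w \<in> M" for M
  proof -
    have "\<forall>\<^sub>F p in filtercomap e (nhds w). e p \<in> M"
      unfolding eventually_filtercomap_nhds using that by blast
    then show ?thesis unfolding F'_def by (rule filter_leD[OF inf_le1])
  qed
  have F'_le: "\<forall>\<^sub>F p in F'. P p" if "\<forall>\<^sub>F p in F. P p" for P
    using that unfolding F'_def by (rule filter_leD[OF inf_le2])
  have F': "F' \<noteq> bot"
  proof
    assume "F' = bot"
    then have "\<forall>\<^sub>F p in F'. False" by simp
    then obtain S Q where SQ: "open S" "w \<in> S" "eventually Q F" "\<forall>p. e p \<in> S \<and> Q p \<longrightarrow> False"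
      unfolding F'_def eventually_inf eventually_filtercomap_nhds by blast
    have "\<forall>\<^sub>F x in filtermap e F. x \<notin> S"
      unfolding eventually_filtermap using SQ(3) by eventually_elim (use SQ(4) in blast)
    moreover have "\<forall>\<^sub>F x in nhds w. x \<in> S" using SQ(1,2) by (rule eventually_nhds_in_open)
    ultimately have "\<forall>\<^sub>F x in inf (nhds w) (filtermap e F). False"
      unfolding eventually_inf by blast
    then show False using w(2) by (simp add: trivial_limit_def)
  qed
  \<comment> \<open>The inverses enter because an element \<open>t + - g\<close> of the piece at
    \<open>- g\<close> sends the exit point \<open>act g v\<close> to \<open>act t v\<close>, with
    \<open>t\<close> shorter than \<open>g\<close>.\<close>
  define H where "H = filtermap (\<lambda>p. - snd p) F'"
  define C where "C = {y. \<forall>N. open N \<and> y \<in> N \<longrightarrow> (\<exists>\<^sub>F g in H. cone_piece \<Gamma> g \<inter> N \<noteq> {})}"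
  have "is_cone \<Gamma> C"
    unfolding C_def
  proof (rule is_cone_of_filter[OF generated])
    show "H \<noteq> bot" using F' by (simp add: H_def filtermap_bot_iff)
    show "filterlim ?w at_top H"
      unfolding filterlim_at_top H_def eventually_filtermap word_length_uminus[OF generated]
      using F'_le[OF long] by blast
  qed
  moreover have "w \<in> - U" using w(1) by (simp add: K_def)
  moreover have "open (- U)" using compact_imp_closed[OF U(1)] by (simp add: open_Compl)
  ultimately have "(\<lambda>c. act c w) ` C \<inter> - U \<noteq> {}"
    using recurrent[of w] unfolding recurrent_type_I_def by blast
  then obtain c where c: "c \<in> C" "act c w \<in> - U" by blast
  \<comment> \<open>\<open>U\<close> is closed, so lying outside it is an open condition; the box
    \<open>N \<times> M\<close> transfers it from the limit pair \<open>(c, w)\<close> to an actual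
    exit point and an actual element of a cone piece.\<close>
  have "(c, w) \<in> {p. act (fst p) (snd p) \<in> - U}" using c(2) by simp
  then obtain N M where NM: "open N" "open M" "(c, w) \<in> N \<times> M"
      "N \<times> M \<subseteq> {p. act (fst p) (snd p) \<in> - U}"
    by (rule open_prod_elim[OF open_act_vimage[OF \<open>open (- U)\<close>]])
  then have "c \<in> N" "w \<in> M" by auto
  have "\<exists>\<^sub>F g in H. cone_piece \<Gamma> g \<inter> N \<noteq> {}" using c(1) NM(1) \<open>c \<in> N\<close> unfolding C_def by blast
  then have "\<exists>\<^sub>F p in F'. cone_piece \<Gamma> (- snd p) \<inter> N \<noteq> {}"
    by (simp add: H_def frequently_filtermap)
  from frequently_eventually_conj[OF this eventually_conj[OF evF'[OF NM(2) \<open>w \<in> M\<close>]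
      eventually_conj[OF F'_le[OF B] F'_le[OF long[of 1]]]]]
  obtain p where p: "cone_piece \<Gamma> (- snd p) \<inter> N \<noteq> {}" "e p \<in> M" "p \<in> B" "1 \<le> ?w (snd p)"
    by (auto dest!: frequently_ex)
  obtain v g where vg: "p = (v, g)" by force
  obtain t where t: "t \<in> sumset_power \<Gamma> (?w g - 1)" "t + - g \<in> N"
    using p(1) by (auto simp: vg cone_piece_def set_plus_def word_length_uminus[OF generated])
  have "act (t + - g) (act g v) \<in> - U" using NM(4) t(2) p(2) by (auto simp: vg e_def)
  then have "act t v \<notin> U" by (simp add: act_add del: add_uminus_conv_diff)
  \<comment> \<open>Subtraction on naturals is truncated; \<open>1 \<le> ?w (snd p)\<close> is what
    makes this strict.\<close>
  moreover have "?w t < ?w g"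
    using t(1) p(4) by (simp add: vg sumset_power_iff_word_length[OF generated])
  ultimately show False using p(3) by (auto simp: vg B_def)
qed

lemma recurrent_type_I_if_minimal:
  assumes generated: "compactly_generated_by \<Gamma>"
    and cpt: "compact (closure (range (\<lambda>g. act g z)))"
    and minimal: "\<And>y. y \<in> closure (range (\<lambda>g. act g z)) \<Longrightarrow> z \<in> closure (range (\<lambda>g. act g y))"
  shows "recurrent_type_I \<Gamma> act z"
  unfolding recurrent_type_I_def
proof (intro allI impI, elim conjE)
  fix C U assume C: "is_cone \<Gamma> C" and U: "open U" "z \<in> U"
  let ?K = "closure (range (\<lambda>g. act g z))"
  \<comment> \<open>By minimality every point of the orbit closure is moved into \<open>U\<close> by
    some element, so the preimages of \<open>U\<close> cover it.\<close>
  have "?K \<subseteq> (\<Union>g\<in>UNIV. act g -` U)"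
  proof
    fix y assume "y \<in> ?K"
    then have "U \<inter> range (\<lambda>g. act g y) \<noteq> {}"
      using open_Int_closure_eq_empty[OF U(1)] U(2) minimal by blast
    then show "y \<in> (\<Union>g\<in>UNIV. act g -` U)" by blast
  qed
  moreover have "open (act g -` U)" for g using open_vimage[OF U(1) continuous_on_act] .
  ultimately obtain T where T: "finite T" "?K \<subseteq> (\<Union>g\<in>T. act g -` U)"
    using compactE_image[OF cpt, of UNIV "\<lambda>g. act g -` U"] by metis
  define r where "r = Max (word_length \<Gamma> ` T)"
  have T_r: "g \<in> sumset_power \<Gamma> r" if "g \<in> T" for g
    using T(1) that by (simp add: r_def sumset_power_iff_word_length[OF generated])
  obtain h where h: "sumset_power \<Gamma> r + {h} \<subseteq> C" using translate_subset_cone[OF generated C] by blast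
  \<comment> \<open>The finite cover is applied at \<open>act h z\<close>, so that the element
    \<open>g\<close> found there combines with \<open>h\<close> to a member of the translate inside
    \<open>C\<close>.\<close>
  have "act h z \<in> ?K" using closure_subset[of "range (\<lambda>g. act g z)"] by auto
  then obtain g where g: "g \<in> T" "act g (act h z) \<in> U" using T(2) by blast
  have "g + h \<in> C" using h set_plus_intro[OF T_r[OF g(1)], of h "{h}"] by auto
  moreover have "act (g + h) z \<in> U" using g(2) by (simp add: act_add)
  ultimately show "(\<lambda>c. act c z) ` C \<inter> U \<noteq> {}" by blast
qed

end


section \<open>Enveloping semigroups\<close>

lemma compact_imp_closed_fun:
  fixes S :: "('a \<Rightarrow> 'b::t2_space) set"
  assumes "compact S"
  shows "closed S"
proof -
  have "Hausdorff_space (euclidean :: 'b topology)"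
    unfolding Hausdorff_space_def by (simp add: disjnt_def) (metis hausdorff)
  then have "Hausdorff_space (euclidean :: ('a \<Rightarrow> 'b) topology)"
    by (simp add: Hausdorff_space_product_topology flip: euclidean_product_topology)
  then show ?thesis using compactin_imp_closedin[of euclidean S] assms by simp
qed

text \<open>Tychonoff's theorem, with a factor depending on the coordinate.\<close>

lemma compact_Pi_UNIV:
  fixes K :: "'a \<Rightarrow> 'b::topological_space set"
  assumes "\<And>x. compact (K x)"
  shows "compact {f. \<forall>x. f x \<in> K x}"
proof -
  have "compactin (product_topology (\<lambda>_. euclidean) UNIV) (PiE UNIV K)"
    using assms by (simp add: compactin_PiE)
  then show ?thesis by (simp add: euclidean_product_topology PiE_UNIV_domain Pi_def)
qed

text \<open>Works for arbitrary \<open>q\<close>: the value of \<open>p \<circ> q\<close> at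
  \<open>x\<close> is a coordinate of \<open>p\<close>, namely the one at \<open>q x\<close>.
  Continuity in \<open>q\<close> is a different matter, as \<open>p\<close> may be
  discontinuous.\<close>

lemma continuous_on_comp_right: "continuous_on UNIV (\<lambda>p. p \<circ> (q :: 'a \<Rightarrow> 'b) :: 'a \<Rightarrow> 'c::topological_space)"
  by (auto simp: o_def intro!: continuous_on_coordinatewise_then_product)

lemma continuous_on_eval_pair: "continuous_on UNIV (\<lambda>p. (p x, p y) :: 'b::topological_space \<times> 'b)"
  by (rule continuous_on_Pair[OF continuous_on_product_coordinates continuous_on_product_coordinates])

text \<open>
  Numakura's lemma for semigroups of self-maps: a minimal closed subsemigroup \<open>M\<close> satisfies
  \<open>M \<circ> p = M\<close> and then \<open>{q \<in> M. q \<circ> p = p} = M\<close> for each \<open>p \<in> M\<close>.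
\<close>

lemma compact_semigroup_has_idempotent:
  fixes S :: "('a \<Rightarrow> 'a::t2_space) set"
  assumes "compact S" "S \<noteq> {}" and S_comp: "\<And>p q. p \<in> S \<Longrightarrow> q \<in> S \<Longrightarrow> p \<circ> q \<in> S"
  shows "\<exists>u\<in>S. u \<circ> u = u"
proof -
  define \<S> where "\<S> = {T. T \<subseteq> S \<and> closed T \<and> T \<noteq> {} \<and> (\<forall>p\<in>T. \<forall>q\<in>T. p \<circ> q \<in> T)}"
  have "S \<in> \<S>"
    using assms compact_imp_closed_fun[OF \<open>compact S\<close>] by (auto simp: \<S>_def)
  \<comment> \<open>Zorn's lemma yields maximal elements, so it is applied to complements; the union
    of a chain of them is the complement of an intersection of subsemigroups, nonempty by
    compactness of \<open>S\<close>.\<close>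
  have "\<exists>M\<in>uminus ` \<S>. \<forall>X\<in>uminus ` \<S>. M \<subseteq> X \<longrightarrow> X = M"
  proof (rule subset_Zorn_nonempty)
    show "uminus ` \<S> \<noteq> {}" using \<open>S \<in> \<S>\<close> by blast
    fix \<C> assume ne: "\<C> \<noteq> {}" and ch: "subset.chain (uminus ` \<S>) \<C>"
    define \<F> where "\<F> = uminus ` \<C>"
    have \<F>: "\<F> \<subseteq> \<S>" using ch by (auto simp: \<F>_def subset_chain_def)
    have lin: "A \<subseteq> B \<or> B \<subseteq> A" if AB: "A \<in> \<F>" "B \<in> \<F>" for A B
    proof -
      have "- A \<in> \<C>" "- B \<in> \<C>" using AB by (auto simp: \<F>_def)
      then have "- A \<subseteq> - B \<or> - B \<subseteq> - A" using ch by (simp only: subset_chain_def)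
      then show ?thesis by auto
    qed
    have "S \<inter> \<Inter>\<F> \<noteq> {}"
    proof (rule compact_imp_fip[OF \<open>compact S\<close>])
      show "closed T" if "T \<in> \<F>" for T using that \<F> by (auto simp: \<S>_def)
    next
      fix \<F>' assume fin: "finite \<F>'" and sub: "\<F>' \<subseteq> \<F>"
      show "S \<inter> \<Inter>\<F>' \<noteq> {}"
      proof (cases "\<F>' = {}")
        case False
        moreover have "subset.chain UNIV \<F>'" using sub lin by (auto simp: subset_chain_def)
        ultimately have "\<Inter>\<F>' \<in> \<F>'" using fin by (intro Inter_in_chain)
        then have "\<Inter>\<F>' \<in> \<S>" using \<F> sub by blast
        then show ?thesis by (auto simp: \<S>_def)
      qed (simp add: \<open>S \<noteq> {}\<close>)
    qed
    moreover obtain T where "T \<in> \<F>" using ne by (auto simp: \<F>_def)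
    moreover have "closed (\<Inter>\<F>)" using \<F> by (intro closed_Inter) (auto simp: \<S>_def)
    moreover have "p \<circ> q \<in> \<Inter>\<F>" if "p \<in> \<Inter>\<F>" "q \<in> \<Inter>\<F>" for p q
      using that \<F> by (auto simp: \<S>_def)
    ultimately have "\<Inter>\<F> \<in> \<S>" using \<F> unfolding \<S>_def by blast
    moreover have "\<Union>\<C> = - \<Inter>\<F>" by (auto simp: \<F>_def)
    ultimately show "\<Union>\<C> \<in> uminus ` \<S>" by blast
  qed
  then obtain M where M: "M \<in> \<S>" and minimal: "\<And>T. T \<in> \<S> \<Longrightarrow> T \<subseteq> M \<Longrightarrow> T = M"
    by (force simp: image_iff)
  have M_comp: "p \<circ> q \<in> M" if "p \<in> M" "q \<in> M" for p q using M that by (auto simp: \<S>_def)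
  have "compact M"
    using M \<open>compact S\<close> compact_Int_closed[of S M] by (auto simp: \<S>_def inf_absorb2)
  obtain p where p: "p \<in> M" using M by (auto simp: \<S>_def)
  have "compact ((\<lambda>q. q \<circ> p) ` M)"
    by (rule compact_continuous_image[OF continuous_on_subset[OF continuous_on_comp_right subset_UNIV]
          \<open>compact M\<close>])
  then have "closed ((\<lambda>q. q \<circ> p) ` M)" by (rule compact_imp_closed_fun)
  moreover have "(q \<circ> p) \<circ> (r \<circ> p) \<in> (\<lambda>q. q \<circ> p) ` M" if "q \<in> M" "r \<in> M" for q r
    using M_comp[OF M_comp[OF that(1) p] that(2)] by (auto simp: o_assoc)
  moreover have "(\<lambda>q. q \<circ> p) ` M \<subseteq> S" using M p M_comp by (auto simp: \<S>_def subset_iff)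
  ultimately have "(\<lambda>q. q \<circ> p) ` M \<in> \<S>" using p by (auto simp: \<S>_def)
  then have "(\<lambda>q. q \<circ> p) ` M = M" using minimal p M_comp by auto
  then obtain q where q: "q \<in> M" "q \<circ> p = p" using p by (metis imageE)
  \<comment> \<open>The element \<open>q\<close> just found makes \<open>N\<close> nonempty;
    minimality then puts \<open>p\<close> itself into \<open>N\<close>.\<close>
  define N where "N = M \<inter> (\<lambda>q. q \<circ> p) -` {p}"
  have "closed {p}" by (rule compact_imp_closed_fun) simp
  then have "closed N"
    using M unfolding N_def by (intro closed_Int closed_vimage continuous_on_comp_right) (auto simp: \<S>_def)
  moreover have "q \<in> N" using q by (simp add: N_def)
  ultimately have "N \<in> \<S>"
    using M M_comp by (auto simp: \<S>_def N_def comp_assoc)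
  then have "p \<in> N" using minimal[of N] p by (auto simp: N_def)
  then have "p \<circ> p = p" by (simp add: N_def)
  moreover have "p \<in> S" using p M by (auto simp: \<S>_def)
  ultimately show ?thesis by blast
qed

section \<open>The enveloping semigroup of an action\<close>

context continuous_action
begin

text \<open>The Ellis semigroup: the closure is that of pointwise convergence, so members may be
  discontinuous.\<close>

definition enveloping_semigroup :: "('z \<Rightarrow> 'z) set"
  where "enveloping_semigroup = closure (range act)"

text \<open>Limits are taken in one factor at a time: first in \<open>q\<close>, with a continuous
  \<open>act g\<close> on the left, then in \<open>p\<close>, with \<open>q\<close> fixed on the
  right. The order matters because composing with a limit map on the left may fail to be
  continuous.\<close>

lemma enveloping_semigroup_comp:
  assumes "p \<in> enveloping_semigroup" "q \<in> enveloping_semigroup"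
  shows "p \<circ> q \<in> enveloping_semigroup"
proof -
  have act_comp: "act g \<circ> q \<in> enveloping_semigroup" if "q \<in> enveloping_semigroup" for g q
  proof -
    have "continuous_on UNIV (\<lambda>q. act g (q x))" for x
      by (rule continuous_on_compose2[OF continuous_on_act continuous_on_product_coordinates]) simp
    then have cont: "continuous_on UNIV (\<lambda>q. act g \<circ> q)"
      unfolding o_def by (rule continuous_on_coordinatewise_then_product)
    have "act g \<circ> act h = act (g + h)" for h by (auto simp: act_add)
    then have "(\<lambda>q. act g \<circ> q) ` range act \<subseteq> closure (range act)"
      using closure_subset[of "range act"] by auto
    then have "(\<lambda>q. act g \<circ> q) ` closure (range act) \<subseteq> closure (range act)"
      by (rule image_closure_subset[OF continuous_on_subset[OF cont subset_UNIV] closed_closure])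
    then show ?thesis using that unfolding enveloping_semigroup_def by blast
  qed
  have "(\<lambda>p. p \<circ> q) ` closure (range act) \<subseteq> enveloping_semigroup"
  proof (rule image_closure_subset[OF continuous_on_subset[OF continuous_on_comp_right subset_UNIV]])
    show "closed enveloping_semigroup" by (simp add: enveloping_semigroup_def)
    show "(\<lambda>p. p \<circ> q) ` range act \<subseteq> enveloping_semigroup" using act_comp[OF assms(2)] by blast
  qed
  then show ?thesis using assms(1) unfolding enveloping_semigroup_def by blast
qed

text \<open>It is a closed subset of the product of the compact orbit closures.\<close>

lemma compact_enveloping_semigroup:
  assumes "\<And>x. compact (closure (range (\<lambda>g. act g x)))"
  shows "compact enveloping_semigroup"
proof -
  let ?P = "{f. \<forall>x. f x \<in> closure (range (\<lambda>g. act g x))}"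
  have P: "compact ?P" using assms by (rule compact_Pi_UNIV)
  have "range act \<subseteq> ?P" using closure_subset by fastforce
  then have "enveloping_semigroup \<subseteq> ?P"
    unfolding enveloping_semigroup_def by (rule closure_minimal) (rule compact_imp_closed_fun[OF P])
  then show ?thesis
    using compact_Int_closed[OF P, of enveloping_semigroup]
    by (simp add: enveloping_semigroup_def inf_absorb2)
qed

lemma pair_in_orbit_closure:
  assumes "p \<in> enveloping_semigroup"
  shows "(p x, p y) \<in> closure (range (\<lambda>g. (act g x, act g y)))"
proof -
  have "(\<lambda>p. (p x, p y)) ` range act \<subseteq> closure (range (\<lambda>g. (act g x, act g y)))"
    using closure_subset[of "range (\<lambda>g. (act g x, act g y))"] by auto
  then have "(\<lambda>p. (p x, p y)) ` closure (range act) \<subseteq> closure (range (\<lambda>g. (act g x, act g y)))"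
    by (rule image_closure_subset[OF continuous_on_subset[OF continuous_on_eval_pair subset_UNIV]
          closed_closure])
  then show ?thesis using assms unfolding enveloping_semigroup_def by blast
qed

text \<open>The image of the compact enveloping semigroup under evaluation at \<open>x\<close> and
  \<open>y\<close> is closed and contains the orbit of the pair, hence its closure.\<close>

lemma orbit_closure_pair:
  assumes "\<And>x. compact (closure (range (\<lambda>g. act g x)))"
    and "r \<in> closure (range (\<lambda>g. (act g x, act g y)))"
  obtains p where "p \<in> enveloping_semigroup" "r = (p x, p y)"
proof -
  have "compact ((\<lambda>p. (p x, p y)) ` enveloping_semigroup)"
    by (rule compact_continuous_image[OF continuous_on_subset[OF continuous_on_eval_pair subset_UNIV]
          compact_enveloping_semigroup[OF assms(1)]])
  moreover have "range (\<lambda>g. (act g x, act g y)) \<subseteq> (\<lambda>p. (p x, p y)) ` enveloping_semigroup"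
    using closure_subset[of "range act"] by (auto simp: enveloping_semigroup_def)
  ultimately have "closure (range (\<lambda>g. (act g x, act g y))) \<subseteq> (\<lambda>p. (p x, p y)) ` enveloping_semigroup"
    by (intro closure_minimal compact_imp_closed)
  then show ?thesis using assms(2) that by blast
qed

text \<open>\<open>u\<close> sends both \<open>x\<close> and \<open>u x\<close> to
  \<open>u x\<close>, so the orbit closure of \<open>(x, u x)\<close> meets the diagonal and
  distality gives \<open>u x = x\<close>.\<close>

lemma distal_idempotent_eq_id:
  assumes "distal act" "u \<in> enveloping_semigroup" "u \<circ> u = u"
  shows "u = id"
proof
  fix x
  have "(u x, u (u x)) \<in> closure (range (\<lambda>g. (act g x, act g (u x))))"
    using assms(2) by (rule pair_in_orbit_closure)
  moreover have "u (u x) = u x" using assms(3) by (metis comp_apply)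
  ultimately show "u x = id x"
    using assms(1) unfolding distal_def by (metis IntI pair_in_Id_conv empty_iff id_apply)
qed

text \<open>For each \<open>p\<close> in the enveloping semigroup \<open>E\<close>, the idempotent of the left ideal \<open>E \<circ> p\<close> is
  the identity, so \<open>p\<close> has a left inverse in \<open>E\<close>.\<close>

lemma distal_orbit_closure_minimal:
  assumes "distal act" and cpt: "\<And>x. compact (closure (range (\<lambda>g. act g x)))"
    and "(x', y') \<in> closure (range (\<lambda>g. (act g x, act g y)))"
  shows "(x, y) \<in> closure (range (\<lambda>g. (act g x', act g y')))"
proof -
  obtain p where p: "p \<in> enveloping_semigroup" "(x', y') = (p x, p y)"
    using orbit_closure_pair[OF cpt assms(3)] .
  let ?L = "(\<lambda>q. q \<circ> p) ` enveloping_semigroup"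
  have "compact ?L"
    by (rule compact_continuous_image[OF continuous_on_subset[OF continuous_on_comp_right subset_UNIV]
          compact_enveloping_semigroup[OF cpt]])
  moreover have "q \<circ> r \<in> ?L" if qr: "q \<in> ?L" "r \<in> ?L" for q r
  proof -
    obtain s t where "s \<in> enveloping_semigroup" "t \<in> enveloping_semigroup" "q = s \<circ> p" "r = t \<circ> p"
      using qr by blast
    then have "q \<circ> r = (s \<circ> p \<circ> t) \<circ> p" "s \<circ> p \<circ> t \<in> enveloping_semigroup"
      using p(1) by (auto simp: comp_assoc intro!: enveloping_semigroup_comp)
    then show ?thesis by blast
  qed
  ultimately obtain u where u: "u \<in> ?L" "u \<circ> u = u"
    using compact_semigroup_has_idempotent[of ?L] p(1) by blast
  then obtain q where q: "q \<in> enveloping_semigroup" "u = q \<circ> p" by blast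
  have "u \<in> enveloping_semigroup" using enveloping_semigroup_comp[OF q(1) p(1)] q(2) by simp
  then have "q \<circ> p = id" using distal_idempotent_eq_id[OF assms(1) _ u(2)] q(2) by simp
  \<comment> \<open>The left inverse \<open>q\<close> carries the limit pair back to the original
    one.\<close>
  then have "(q x', q y') = (x, y)" using p(2) by (metis Pair_inject comp_apply id_apply)
  then show ?thesis using pair_in_orbit_closure[OF q(1), of x' y'] by simp
qed

end


section \<open>Distality, equicontinuity and recurrence\<close>

lemma flow_imp_continuous_action:
  assumes "flow act"
  shows "continuous_action act"
  using assms unfolding flow_def continuous_action_def by simp

lemma flow_imp_continuous_action_prod:
  assumes "flow act"
  shows "continuous_action (prod_act act)"
proof
  interpret continuous_action act using assms by (rule flow_imp_continuous_action)
  have "continuous_on UNIV (\<lambda>q :: 'a \<times> 'b \<times> 'b. (\<lambda>(t, x). act t x) (fst q, fst (snd q)))"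
    by (rule continuous_on_compose2[OF continuous_act]) (auto intro!: continuous_intros)
  moreover have "continuous_on UNIV (\<lambda>q :: 'a \<times> 'b \<times> 'b. (\<lambda>(t, x). act t x) (fst q, snd (snd q)))"
    by (rule continuous_on_compose2[OF continuous_act]) (auto intro!: continuous_intros)
  ultimately show "continuous_on UNIV (\<lambda>(t, x). prod_act act t x)"
    by (simp add: prod_act_def case_prod_unfold continuous_on_Pair)
  show "prod_act act 0 p = p" for p by (simp add: prod_act_def case_prod_unfold)
  show "prod_act act (s + t) p = prod_act act s (prod_act act t p)" for s t p
    by (simp add: prod_act_def case_prod_unfold act_add)
qed

lemma equicontinuous_imp_distal:
  fixes act :: "'g::{group_add, topological_monoid_add, t2_space} \<Rightarrow> 'x::{uniform_space, t2_space} \<Rightarrow> 'x"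
  assumes "flow act" "equicontinuous act"
  shows "distal act"
  unfolding distal_def
proof (intro allI impI)
  interpret continuous_action act using assms(1) by (rule flow_imp_continuous_action)
  fix x y :: 'x assume "x \<noteq> y"
  show "closure (range (\<lambda>g. (act g x, act g y))) \<inter> Id = {}"
  proof (rule ccontr)
    assume "\<not> ?thesis"
    then obtain z where z: "(z, z) \<in> closure (range (\<lambda>g. (act g x, act g y)))" by auto
    \<comment> \<open>\<open>\<delta>\<close> will be such that two \<open>\<delta>\<close>-steps
      starting at \<open>x\<close> end in \<open>N\<close>, hence cannot reach
      \<open>y\<close>.\<close>
    obtain N where N: "open N" "x \<in> N" "y \<notin> N" using t1_space[OF \<open>x \<noteq> y\<close>] by blast
    then have "\<forall>\<^sub>F p in uniformity. fst p = x \<longrightarrow> snd p \<in> N"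
      unfolding open_uniformity by (auto simp: case_prod_unfold)
    then obtain \<delta> where \<delta>: "\<forall>\<^sub>F p in uniformity. \<delta> p"
      "\<And>a b c. \<delta> (a, b) \<Longrightarrow> \<delta> (b, c) \<Longrightarrow> a = x \<longrightarrow> c \<in> N"
      by (rule uniformity_transE) auto
    have "\<forall>\<^sub>F p in uniformity. p \<in> {(a, b). \<delta> (a, b) \<and> \<delta> (b, a)}"
      using eventually_conj[OF \<delta>(1) uniformity_sym[OF \<delta>(1)]] by (simp add: case_prod_unfold)
    then obtain U where U: "open U" "z \<in> U"
      "\<And>g. act g ` U \<subseteq> {(a, b). \<delta> (a, b) \<and> \<delta> (b, a)} `` {act g z}"
      using assms(2) unfolding equicontinuous_def by meson
    have "U \<times> U \<inter> range (\<lambda>g. (act g x, act g y)) \<noteq> {}"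
      using open_Int_closure_eq_empty[OF open_Times[OF U(1) U(1)]] U(2) z by blast
    then obtain g where g: "act g x \<in> U" "act g y \<in> U" by auto
    \<comment> \<open>Equicontinuity at \<open>z\<close>, used for the inverse \<open>- g\<close>,
      makes \<open>x\<close> and \<open>y\<close> both \<open>\<delta>\<close>-close to
      \<open>act (- g) z\<close>, which gives a forbidden pair of steps from \<open>x\<close> to
      \<open>y\<close>.\<close>
    have "act (- g) (act g x) \<in> act (- g) ` U" "act (- g) (act g y) \<in> act (- g) ` U"
      using g by blast+
    then have "\<delta> (x, act (- g) z)" "\<delta> (act (- g) z, y)" using U(3)[of "- g"] by auto
    then show False using \<delta>(2) N(3) by blast
  qed
qed

lemma distal_imp_product_recurrent:
  fixes act :: "'g::{group_add, topological_monoid_add, t2_space} \<Rightarrow> 'x::{uniform_space, t2_space} \<Rightarrow> 'x"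
  assumes "flow act" "compactly_generated_by \<Gamma>" "distal act"
  shows "pointwise_product_recurrent_type_I \<Gamma> act"
  unfolding pointwise_product_recurrent_type_I_def
proof
  interpret continuous_action act using assms(1) by (rule flow_imp_continuous_action)
  interpret prod: continuous_action "prod_act act" using assms(1) by (rule flow_imp_continuous_action_prod)
  have cpt: "compact (closure (range (\<lambda>g. act g x)))" for x using assms(1) by (simp add: flow_def)
  fix p :: "'x \<times> 'x"
  obtain x y where p: "p = (x, y)" by force
  let ?K = "closure (range (\<lambda>g. act g x)) \<times> closure (range (\<lambda>g. act g y))"
  show "recurrent_type_I \<Gamma> (prod_act act) p"
  proof (rule prod.recurrent_type_I_if_minimal[OF assms(2)])
    have "closure (range (\<lambda>g. (act g x, act g y))) \<subseteq> ?K"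
      using closure_subset[of "range (\<lambda>g. act g x)"] closure_subset[of "range (\<lambda>g. act g y)"]
      by (intro closure_minimal closed_Times) auto
    then have "?K \<inter> closure (range (\<lambda>g. (act g x, act g y))) = closure (range (\<lambda>g. (act g x, act g y)))"
      by (rule inf_absorb2)
    then show "compact (closure (range (\<lambda>g. prod_act act g p)))"
      using compact_Int_closed[OF compact_Times[OF cpt cpt] closed_closure,
          of x y "range (\<lambda>g. (act g x, act g y))"] by (simp add: p prod_act_def)
    show "p \<in> closure (range (\<lambda>g. prod_act act g q))"
      if "q \<in> closure (range (\<lambda>g. prod_act act g p))" for q
      using distal_orbit_closure_minimal[OF assms(3) cpt] that
      by (cases q) (simp add: p prod_act_def)
  qed
qed

text \<open>Local compactness cuts the clopen base down to compact open sets, and boxes of these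
  give small compact open neighbourhoods in the product. Finitely many boxes cover \<open>K\<close>;
  their union is still compact and open.\<close>

lemma compact_open_between:
  fixes K W :: "('x::t2_space \<times> 'x) set"
  assumes "locally compact (UNIV :: 'x set)" and "clopen_base TYPE('x)"
    and "compact K" "open W" "K \<subseteq> W"
  obtains U where "compact U" "open U" "K \<subseteq> U" "U \<subseteq> W"
proof -
  obtain B :: "'x set set" where B: "topological_basis B" "\<forall>U\<in>B. open U \<and> closed U"
    using assms(2) unfolding clopen_base_def by (elim exE conjE)
  have base: "\<exists>V. open V \<and> compact V \<and> x \<in> V \<and> V \<subseteq> N" if N: "open N" "x \<in> N" for x :: 'x and N
  proof -
    have "\<exists>S T. openin (top_of_set UNIV) S \<and> compact T \<and> x \<in> S \<and> S \<subseteq> T \<and> T \<subseteq> UNIV"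
      by (rule assms(1)[unfolded locally_def, rule_format]) simp
    then obtain S T where "openin (top_of_set UNIV) S" and ST: "compact T" "x \<in> S" "S \<subseteq> T"
      by (elim exE conjE)
    then have S: "open S" by simp
    obtain V where V: "V \<in> B" "x \<in> V" "V \<subseteq> N \<inter> S"
      using topological_basisE[OF B(1) open_Int[OF N(1) S], of x] N(2) ST(2) by auto
    then have "T \<inter> V = V" using ST(3) by blast
    then have "compact V"
      using compact_Int_closed[OF ST(1), of V] B(2) V(1) by simp
    then show ?thesis using V B(2) by auto
  qed
  have "\<exists>V. open V \<and> compact V \<and> p \<in> V \<and> V \<subseteq> W" if "p \<in> K" for p
  proof -
    have "p \<in> W" using that assms(5) by blast
    then obtain N M where NM: "open N" "open M" "p \<in> N \<times> M" "N \<times> M \<subseteq> W"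
      by (rule open_prod_elim[OF assms(4)])
    obtain V V' where V: "open V" "compact V" "fst p \<in> V" "V \<subseteq> N"
      "open V'" "compact V'" "snd p \<in> V'" "V' \<subseteq> M"
      using base[OF NM(1), of "fst p"] base[OF NM(2), of "snd p"] NM(3) by (auto simp: mem_Times_iff)
    then have "p \<in> V \<times> V'" "V \<times> V' \<subseteq> W" using NM(4) by (auto simp: mem_Times_iff)
    then show ?thesis using open_Times[OF V(1,5)] compact_Times[OF V(2,6)] by blast
  qed
  then obtain V where V: "\<And>p. p \<in> K \<Longrightarrow> open (V p) \<and> compact (V p) \<and> p \<in> V p \<and> V p \<subseteq> W" by metis
  obtain T where T: "T \<subseteq> K" "finite T" "K \<subseteq> (\<Union>p\<in>T. V p)"
    using compactE_image[OF assms(3), of K V] V by blast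
  have "compact (\<Union>p\<in>T. V p)" using T V by (intro compact_UN) auto
  moreover have "open (\<Union>p\<in>T. V p)" using T V by (intro open_UN) auto
  moreover have "(\<Union>p\<in>T. V p) \<subseteq> W" using T V by blast
  ultimately show ?thesis using T(3) by (intro that)
qed

lemma product_recurrent_imp_equicontinuous:
  fixes act :: "'g::{group_add, topological_monoid_add, t2_space} \<Rightarrow> 'x::{uniform_space, t2_space} \<Rightarrow> 'x"
  assumes "flow act" "clopen_base TYPE('x)" "compactly_generated_by \<Gamma>"
    and "pointwise_product_recurrent_type_I \<Gamma> act"
  shows "equicontinuous act"
  unfolding equicontinuous_def
proof (intro allI impI)
  interpret continuous_action "prod_act act" using assms(1) by (rule flow_imp_continuous_action_prod)
  fix x :: 'x and \<epsilon> :: "('x \<times> 'x) set"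
  assume "\<forall>\<^sub>F p in uniformity. p \<in> \<epsilon>"
  from uniformity_trans[OF this]
  obtain \<delta> where \<delta>: "\<forall>\<^sub>F p in uniformity. \<delta> p"
      "\<forall>a b c. \<delta> (a, b) \<longrightarrow> \<delta> (b, c) \<longrightarrow> (a, c) \<in> \<epsilon>"
    by (elim exE conjE)
  \<comment> \<open>Any two points of a neighbourhood \<open>N\<close> that is
    \<open>\<delta>\<close>-close to \<open>y\<close> in both directions are
    \<open>\<epsilon>\<close>-close, by passing through \<open>y\<close>.\<close>
  have \<epsilon>_diag: "(y, y) \<in> interior \<epsilon>" for y
  proof -
    have "\<forall>\<^sub>F p in uniformity. fst p = y \<longrightarrow> \<delta> p \<and> \<delta> (snd p, fst p)"
      using eventually_conj[OF \<delta>(1) uniformity_sym[OF \<delta>(1)]]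
      by eventually_elim (auto simp: case_prod_unfold)
    then have "\<forall>\<^sub>F b in nhds y. \<delta> (y, b) \<and> \<delta> (b, y)"
      unfolding eventually_nhds_uniformity by (rule eventually_mono) auto
    then obtain N where N: "open N" "y \<in> N" "\<And>b. b \<in> N \<Longrightarrow> \<delta> (y, b) \<and> \<delta> (b, y)"
      unfolding eventually_nhds by blast
    have "N \<times> N \<subseteq> \<epsilon>" using N(3) \<delta>(2) by blast
    then show ?thesis using N(1,2) by (intro interiorI[OF open_Times[OF N(1) N(1)]]) auto
  qed
  \<comment> \<open>The orbit of \<open>(x, x)\<close> stays on the diagonal, so its closure lies in
    this compact copy of the orbit closure of \<open>x\<close>.\<close>
  let ?\<Delta> = "(\<lambda>y. (y, y)) ` closure (range (\<lambda>g. act g x))"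
  have "compact ?\<Delta>"
    using assms(1) by (intro compact_continuous_image continuous_intros) (simp add: flow_def)
  moreover have "?\<Delta> \<subseteq> interior \<epsilon>" using \<epsilon>_diag by blast
  moreover have "locally compact (UNIV :: 'x set)" using assms(1) by (simp add: flow_def)
  ultimately obtain U where U: "compact U" "open U" "?\<Delta> \<subseteq> U" "U \<subseteq> interior \<epsilon>"
    by (elim compact_open_between[OF _ assms(2) _ open_interior])
  have "act g x \<in> closure (range (\<lambda>g. act g x))" for g
    using closure_subset[of "range (\<lambda>g. act g x)"] by auto
  then have "prod_act act g (x, x) \<in> U" for g
    using U(3) by (auto simp: prod_act_def)
  then have "\<exists>V. open V \<and> (x, x) \<in> V \<and> (\<forall>v\<in>V. \<forall>g. prod_act act g v \<in> U)"
    using assms(4) unfolding pointwise_product_recurrent_type_I_def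
    by (intro orbits_near_stay_in_compact_open[OF assms(3) U(1,2)]) auto
  then obtain V where V: "open V" "(x, x) \<in> V" "\<forall>v\<in>V. \<forall>g. prod_act act g v \<in> U"
    by (elim exE conjE)
  obtain N M where NM: "open N" "open M" "(x, x) \<in> N \<times> M" "N \<times> M \<subseteq> V"
    by (rule open_prod_elim[OF V(1,2)])
  \<comment> \<open>Equicontinuity at \<open>x\<close> compares \<open>x\<close> itself with nearby
    points only, so \<open>M\<close> is the neighbourhood sought.\<close>
  have "(act g x, act g y) \<in> \<epsilon>" if "y \<in> M" for g y
  proof -
    have "(x, y) \<in> V" using NM(3,4) that by blast
    then have "prod_act act g (x, y) \<in> \<epsilon>" using V(3) U(4) interior_subset by blast
    then show ?thesis by (simp add: prod_act_def)
  qed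
  then show "\<exists>U. open U \<and> x \<in> U \<and> (\<forall>g. act g ` U \<subseteq> \<epsilon> `` {act g x})"
    using NM(2,3) by blast
qed

theorem theorem4p1p1:
  fixes act :: "'g::{group_add, topological_monoid_add, t2_space}
                  \<Rightarrow> 'x::{uniform_space, t2_space} \<Rightarrow> 'x"
    and \<Gamma> :: "'g set"
  assumes "flow act"
    and "clopen_base TYPE('x)"
    and "compactly_generated_by \<Gamma>"
  shows "(pointwise_product_recurrent_type_I \<Gamma> act \<longleftrightarrow> distal act) \<and>
         (distal act \<longleftrightarrow> equicontinuous act) \<and>
         (pointwise_product_recurrent_type_I \<Gamma> act \<longleftrightarrow> equicontinuous act)"
  using product_recurrent_imp_equicontinuous[OF assms] equicontinuous_imp_distal[OF assms(1)]
    distal_imp_product_recurrent[OF assms(1,3)] by blast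

end
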